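(* If a hypergraph $H$ is strongly connected and can be seen as an uplift from a pairwise graph $G$, then $H$ has a unique Perron-like $\mathcal Z$-eigenvector, i.e. there is exactly one $\mathcal Z$-eigenvector of the adjacency tensor of $H$ with all components positive.
   Context: A hypergraph $(V,E)$ has a finite node set $V$ and a finite set $E$ of hyperedges, each a multiset of nodes; it is $m$-uniform if every hyperedge has exactly $m$ elements counted with multiplicity. Hyperedges carry positive weights $w(e)$ (equal to $1$ in the unweighted case). The adjacency tensor of an $m$-uniform hypergraph is the symmetric order-$m$ tensor $T$ with $T_{i_1\dots i_m}=w(\{i_1,\dots,i_m\})$ if the multiset $\{i_1,\dots,i_m\}$ is a hyperedge, and $0$ otherwise. Strong connectedness: an order-$m$ tensor $T$ is weakly irreducible if the matrix with entries $m_{ij}=\sum_{j_3,\dots,j_m}|T_{ijj_3\dots j_m}|$ is irreducible; a uniform hypergraph is strongly connected if its adjacency tensor is weakly irreducible (equivalently, the graph joining two nodes whenever some hyperedge contains both is connected). Uplift from a pairwise graph: a pairwise graph is a $2$-uniform (undirected) hypergraph $G=(V_G,E_G)$. A hypergraph $H$ is an uplift of $G$ to order $m$ if there are auxiliary nodes $\star_1,\dots,\star_s\notin V_G$ and multiplicities $p_1,\dots,p_s\ge1$ with $\sum_{k=1}^s p_k=m-2$ such that $H$ has node set $V_G\cup\{\star_1,\dots,\star_s\}$ and its hyperedges are exactly the multisets obtained from the edges $e\in E_G$ by adding $p_k$ copies of $\star_k$ for each $k$. $\mathcal Z$-eigenvector: a real vector $\mathbf c$ with $\mathbf c^T\mathbf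 c=1$ such that $T\mathbf c^{m-1}=\lambda\mathbf c$ for some $\lambda\in\mathbb R$, where $(T\mathbf c^{m-1})_{i_1}=\sum_{i_2,\dots,i_m}T_{i_1i_2\dots i_m}c_{i_2}\cdots c_{i_m}$. A Perron-like $\mathcal Z$-eigenvector is a unique, positive $\mathcal Z$-eigenvector.
   Formalization: The pairwise graph G is itself also assumed strongly connected (so it has a node): otherwise an auxiliary node may link components of G and the claim fails, e.g. for hyperedges {0,1,4} and {2,3,4} there are infinitely many positive Z-eigenvectors. *)

theory Defs
  imports Complex_Main "HOL-Library.Multiset" "HOL-Library.FuncSet"
begin

record 'a hypergraph =
  nodes :: "'a set"
  hyperedges :: "'a multiset set"
  weight :: "'a multiset \<Rightarrow> real"

definition hypergraph :: "'a hypergraph \<Rightarrow> bool" where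
  "hypergraph H \<longleftrightarrow> finite (nodes H) \<and> finite (hyperedges H) \<and>
     (\<forall>e \<in> hyperedges H. set_mset e \<subseteq> nodes H \<and> 0 < weight H e)"

definition uniform :: "nat \<Rightarrow> 'a hypergraph \<Rightarrow> bool" where
  "uniform m H \<longleftrightarrow> (\<forall>e \<in> hyperedges H. size e = m)"

text \<open>Since a graph is a 2-uniform hypergraph whose hyperedges are multisets, loops are allowed.\<close>

definition pairwise_graph :: "'a hypergraph \<Rightarrow> bool" where
  "pairwise_graph G \<longleftrightarrow> hypergraph G \<and> uniform 2 G"

text \<open>
  An order-\<open>m\<close> tensor with index set \<open>V\<close> is a function on lists of indices; only its values on
  \<open>index_tuples V m\<close> matter.
\<close>

definition index_tuples :: "'a set \<Rightarrow> nat \<Rightarrow> 'a list set" where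
  "index_tuples V k = {js. length js = k \<and> set js \<subseteq> V}"

definition adjacency_tensor :: "'a hypergraph \<Rightarrow> 'a list \<Rightarrow> real" where
  "adjacency_tensor H js = (if mset js \<in> hyperedges H then weight H (mset js) else 0)"

text \<open>
  Irreducibility of a square matrix with rows and columns indexed by \<open>V\<close>: no simultaneous
  permutation of rows and columns makes it block triangular. The empty matrix is not irreducible,
  while every 1-by-1 matrix is.
\<close>

definition irreducible_matrix :: "'a set \<Rightarrow> ('a \<Rightarrow> 'a \<Rightarrow> real) \<Rightarrow> bool" where
  "irreducible_matrix V M \<longleftrightarrow> V \<noteq> {} \<and>
     \<not> (\<exists>S. S \<noteq> {} \<and> S \<subset> V \<and> (\<forall>i \<in> S. \<forall>j \<in> V - S. M i j = 0))"

text \<open>Meaningful for \<open>m \<ge> 2\<close> only, because of the truncated subtraction.\<close>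

definition weakly_irreducible :: "'a set \<Rightarrow> nat \<Rightarrow> ('a list \<Rightarrow> real) \<Rightarrow> bool" where
  "weakly_irreducible V m T \<longleftrightarrow>
     irreducible_matrix V (\<lambda>i j. \<Sum>js \<in> index_tuples V (m - 2). \<bar>T (i # j # js)\<bar>)"

definition strongly_connected :: "nat \<Rightarrow> 'a hypergraph \<Rightarrow> bool" where
  "strongly_connected m H \<longleftrightarrow> uniform m H \<and> weakly_irreducible (nodes H) m (adjacency_tensor H)"

text \<open>
  \<open>S\<close> is the set of auxiliary nodes and \<open>p\<close> gives their multiplicities. Writing the multiplicity
  condition as a sum with \<open>+ 2\<close> forces \<open>m \<ge> 2\<close>. The weights of \<open>G\<close> and \<open>H\<close> are unrelated.

  Strong connectedness of \<open>H\<close> does not imply that of \<open>G\<close>, because an auxiliary node lies in all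
  hyperedges and so links the components of \<open>G\<close>. For a disconnected \<open>G\<close> the positive Z-eigenvector
  of \<open>H\<close> can fail to be unique: take the unweighted \<open>H\<close> with hyperedges \<open>{0,1,4}\<close> and \<open>{2,3,4}\<close>,
  the uplift with auxiliary node 4 of two disjoint edges. Then \<open>a (x, x, y, y, 1)\<close> is a positive
  Z-eigenvector whenever \<open>a\<^sup>2 = 1/3\<close>, \<open>x\<^sup>2 + y\<^sup>2 = 1\<close> and \<open>a, x, y > 0\<close>. Hence the theorem requires \<open>G\<close>
  itself to be strongly connected as well.
\<close>

definition uplift :: "nat \<Rightarrow> 'a hypergraph \<Rightarrow> 'a hypergraph \<Rightarrow> bool" where
  "uplift m G H \<longleftrightarrow> (\<exists>S p. finite S \<and> S \<inter> nodes G = {} \<and> (\<forall>k \<in> S. 1 \<le> p k) \<and>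
     (\<Sum>k \<in> S. p k) + 2 = m \<and>
     nodes H = nodes G \<union> S \<and>
     hyperedges H = (\<lambda>e. e + (\<Sum>k \<in> S. replicate_mset (p k) k)) ` hyperedges G)"

text \<open>The vector \<open>T c\<^sup>m\<^sup>-\<^sup>1\<close>.\<close>

definition tensor_apply :: "'a set \<Rightarrow> nat \<Rightarrow> ('a list \<Rightarrow> real) \<Rightarrow> ('a \<Rightarrow> real) \<Rightarrow> 'a \<Rightarrow> real" where
  "tensor_apply V m T c i = (\<Sum>js \<in> index_tuples V (m - 1). T (i # js) * prod_list (map c js))"

text \<open>
  Vectors indexed by \<open>V\<close> are functions in \<open>extensional V\<close>, so that two of them are equal iff they
  agree on \<open>V\<close>.
\<close>

definition Z_eigenvector :: "'a set \<Rightarrow> nat \<Rightarrow> ('a list \<Rightarrow> real) \<Rightarrow> ('a \<Rightarrow> real) \<Rightarrow> bool" where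
  "Z_eigenvector V m T c \<longleftrightarrow> c \<in> extensional V \<and> (\<Sum>i \<in> V. c i * c i) = 1 \<and>
     (\<exists>l::real. \<forall>i \<in> V. tensor_apply V m T c i = l * c i)"

end

theory Submission
  imports "HOL-Analysis.Function_Topology" "HOL-Combinatorics.Multiset_Permutations" Defs
begin

text \<open>
  Let \<open>A\<close> be the adjacency matrix of \<open>G\<close> with the weights of \<open>H\<close>. Multiplying the \<open>i\<close>-th equation
  of \<open>T c\<^sup>m\<^sup>-\<^sup>1 = l c\<close> by \<open>m c\<^sub>i\<close> turns its left-hand side into the sum over all hyperedges of their monomials
  weighted by the multiplicity of \<open>i\<close>. In an uplift every monomial factors through the auxiliary
  nodes, so that for positive \<open>c\<close> the equations at the nodes of \<open>G\<close> say that \<open>c\<close> restricts to an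
  eigenvector of \<open>A\<close>, while those at an auxiliary node \<open>k\<close> say that \<open>c\<^sub>k\<^sup>2\<close> is \<open>p\<^sub>k / 2\<close> times the
  squared norm of that restriction. By Perron-Frobenius for the symmetric irreducible matrix \<open>A\<close> the
  restriction is unique up to scaling, and the normalisation forces its squared norm to be \<open>2 / m\<close>.
\<close>

section \<open>Perron vectors of symmetric irreducible matrices\<close>

definition quad_form :: "'a set \<Rightarrow> ('a \<Rightarrow> 'a \<Rightarrow> real) \<Rightarrow> ('a \<Rightarrow> real) \<Rightarrow> real" where
  "quad_form V A x = (\<Sum>i\<in>V. x i * (\<Sum>j\<in>V. A i j * x j))"

lemma quad_form_scale: "quad_form V A (\<lambda>i. s * x i) = s\<^sup>2 * quad_form V A x"
  by (simp add: quad_form_def sum_distrib_left power2_eq_square ac_simps)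

text \<open>Symmetry of \<open>A\<close> merges the two cross terms. Along a line the form becomes a
  parabola in \<open>t\<close>, on which the variational argument for the maximiser rests.\<close>

lemma quad_form_add:
  assumes sym: "\<And>i j. i \<in> V \<Longrightarrow> j \<in> V \<Longrightarrow> A i j = A j i"
  shows "quad_form V A (\<lambda>i. x i + t * y i) =
    quad_form V A x + 2 * t * (\<Sum>i\<in>V. y i * (\<Sum>j\<in>V. A i j * x j)) + t\<^sup>2 * quad_form V A y"
proof -
  have "(\<Sum>i\<in>V. x i * (\<Sum>j\<in>V. A i j * y j)) = (\<Sum>i\<in>V. \<Sum>j\<in>V. x i * (A i j * y j))"
    by (simp add: sum_distrib_left)
  also have "\<dots> = (\<Sum>j\<in>V. \<Sum>i\<in>V. x i * (A i j * y j))"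
    by (rule sum.swap)
  also have "\<dots> = (\<Sum>j\<in>V. y j * (\<Sum>i\<in>V. A j i * x i))"
    unfolding sum_distrib_left by (intro sum.cong refl) (simp add: sym)
  finally have swap: "(\<Sum>i\<in>V. x i * (\<Sum>j\<in>V. A i j * y j)) = (\<Sum>i\<in>V. y i * (\<Sum>j\<in>V. A i j * x j))" .
  define a where "a i = (\<Sum>j\<in>V. A i j * x j)" for i
  define b where "b i = (\<Sum>j\<in>V. A i j * y j)" for i
  have lin: "(\<Sum>j\<in>V. A i j * (x j + t * y j)) = a i + t * b i" for i
    by (simp add: a_def b_def sum_distrib_left sum.distrib algebra_simps)
  have "quad_form V A (\<lambda>i. x i + t * y i) = (\<Sum>i\<in>V. (x i + t * y i) * (a i + t * b i))"
    by (simp add: quad_form_def lin)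
  also have "\<dots> = (\<Sum>i\<in>V. x i * a i) + t * (\<Sum>i\<in>V. x i * b i)
      + t * (\<Sum>i\<in>V. y i * a i) + t\<^sup>2 * (\<Sum>i\<in>V. y i * b i)"
    unfolding sum_distrib_left sum.distrib[symmetric]
    by (intro sum.cong refl) (simp add: algebra_simps power2_eq_square)
  also have "\<dots> = quad_form V A x + 2 * t * (\<Sum>i\<in>V. y i * a i) + t\<^sup>2 * quad_form V A y"
    using swap by (simp add: quad_form_def a_def b_def)
  finally show ?thesis
    by (simp add: a_def)
qed

text \<open>The nonnegative part of the unit sphere is compact and the form is continuous on it.
  Maximising over nonnegative vectors only gives the maximiser the sign wanted of a Perron
  vector.\<close>

lemma rayleigh_quotient_max:
  assumes fin: "finite V" and "V \<noteq> {}"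
  obtains x where "\<And>i. i \<in> V \<Longrightarrow> 0 \<le> x i" "(\<Sum>i\<in>V. x i * x i) = 1"
    "\<And>y. \<lbrakk>\<And>i. i \<in> V \<Longrightarrow> 0 \<le> y i; (\<Sum>i\<in>V. y i * y i) = 1\<rbrakk> \<Longrightarrow> quad_form V A y \<le> quad_form V A x"
proof -
  \<comment> \<open>Vectors are functions on the whole type. Pinning the coordinates outside
    \<open>V\<close> to 0 makes this box compact by Tychonoff even if the type is infinite.\<close>
  define B where "B = (\<Pi>\<^sub>E i\<in>UNIV. if i \<in> V then {0..1::real} else {0})"
  define K where "K = B \<inter> {x. (\<Sum>i\<in>V. x i * x i) = 1}"
  have coord [continuous_intros]: "continuous_on X (\<lambda>x::'a \<Rightarrow> real. x i)" for X i
    by (rule continuous_on_subset[OF continuous_on_product_coordinates]) simp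
  have "compactin (product_topology (\<lambda>i. euclidean) UNIV) B"
    unfolding B_def compactin_PiE by auto
  then have "compact B"
    by (simp add: euclidean_product_topology)
  moreover have "closed {x::'a \<Rightarrow> real. (\<Sum>i\<in>V. x i * x i) = 1}"
    by (intro closed_Collect_eq continuous_intros)
  ultimately have "compact K"
    unfolding K_def by (rule compact_Int_closed)
  moreover have restr: "(\<lambda>i. if i \<in> V then y i else 0) \<in> K"
    if "\<And>i. i \<in> V \<Longrightarrow> 0 \<le> y i" "(\<Sum>i\<in>V. y i * y i) = 1" for y
  proof -
    have "y i \<le> 1" if "i \<in> V" for i
    proof -
      have "y i * y i \<le> (\<Sum>i\<in>V. y i * y i)"
        using fin that by (intro member_le_sum) auto
      then show ?thesis
        using \<open>(\<Sum>i\<in>V. y i * y i) = 1\<close> abs_square_le_1[of "y i"]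
        by (simp add: power2_eq_square)
    qed
    then show ?thesis
      using that by (auto simp: K_def B_def)
  qed
  moreover have "K \<noteq> {}"
  proof -
    have "(\<lambda>i. if i \<in> V then 1 / sqrt (card V) else 0) \<in> K"
      by (rule restr) (use assms in \<open>auto simp: card_gt_0_iff\<close>)
    then show ?thesis
      by blast
  qed
  moreover have "continuous_on K (quad_form V A)"
    unfolding quad_form_def by (intro continuous_intros)
  ultimately obtain x where x: "x \<in> K" "\<And>y. y \<in> K \<Longrightarrow> quad_form V A y \<le> quad_form V A x"
    using continuous_attains_sup[of K "quad_form V A"] by blast
  show ?thesis
  proof (rule that[of x])
    show "0 \<le> x i" if "i \<in> V" for i
    proof -
      have "x i \<in> (if i \<in> V then {0..1::real} else {0})"
        using x(1) by (auto simp: K_def B_def PiE_def Pi_def)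
      then show ?thesis
        using that by simp
    qed
    show "(\<Sum>i\<in>V. x i * x i) = 1"
      using x(1) by (simp add: K_def)
    fix y assume "\<And>i. i \<in> V \<Longrightarrow> 0 \<le> y i" "(\<Sum>i\<in>V. y i * y i) = (1::real)"
    from x(2)[OF restr[OF this]] show "quad_form V A y \<le> quad_form V A x"
      by (simp add: quad_form_def)
  qed
qed

text \<open>At a zero of \<open>z\<close> the eigenvalue equation is a vanishing sum of nonnegative
  terms, so row \<open>i\<close> of \<open>A\<close> vanishes wherever \<open>z\<close> does not.
  The zero set would split off a block of \<open>A\<close> unless it is all of \<open>V\<close>.
  This yields both the positivity and the uniqueness of Perron vectors.\<close>

lemma irreducible_eigenvector_zero:
  assumes "finite V" and "irreducible_matrix V A"
    and A: "\<And>i j. i \<in> V \<Longrightarrow> j \<in> V \<Longrightarrow> 0 \<le> A i j"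
    and z: "\<And>i. i \<in> V \<Longrightarrow> 0 \<le> z i"
    and eig: "\<And>i. i \<in> V \<Longrightarrow> (\<Sum>j\<in>V. A i j * z j) = r * z i"
    and "k \<in> V" "z k = 0" and "i \<in> V"
  shows "z i = 0"
proof -
  define S where "S = {i \<in> V. z i = 0}"
  have "A i j = 0" if "i \<in> S" "j \<in> V - S" for i j
  proof -
    have "(\<Sum>j\<in>V. A i j * z j) = 0"
      using eig[of i] that by (simp add: S_def)
    then have "A i j * z j = 0"
      using assms(1) A z that by (subst (asm) sum_nonneg_eq_0_iff) (auto simp: S_def)
    then show ?thesis
      using that by (simp add: S_def)
  qed
  moreover have "S \<noteq> {}"
    using \<open>k \<in> V\<close> \<open>z k = 0\<close> by (auto simp: S_def)
  ultimately have "\<not> S \<subset> V"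
    using assms(2) unfolding irreducible_matrix_def by meson
  moreover have "S \<subseteq> V"
    by (simp add: S_def)
  ultimately have "i \<in> S"
    using \<open>i \<in> V\<close> by blast
  then show ?thesis
    by (simp add: S_def)
qed

text \<open>A maximiser of the Rayleigh quotient is an eigenvector, since otherwise moving against
  its residual would increase the quotient. Irreducibility then excludes zero entries.\<close>

theorem perron_vector_exists:
  assumes fin: "finite V" and irr: "irreducible_matrix V A"
    and nonneg: "\<And>i j. i \<in> V \<Longrightarrow> j \<in> V \<Longrightarrow> 0 \<le> A i j"
    and sym: "\<And>i j. i \<in> V \<Longrightarrow> j \<in> V \<Longrightarrow> A i j = A j i"
  obtains x r where "\<And>i. i \<in> V \<Longrightarrow> 0 < x i" "(\<Sum>i\<in>V. x i * x i) = 1"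
    "\<And>i. i \<in> V \<Longrightarrow> (\<Sum>j\<in>V. A i j * x j) = r * x i"
proof -
  have "V \<noteq> {}"
    using irr by (simp add: irreducible_matrix_def)
  with fin obtain x where x: "\<And>i. i \<in> V \<Longrightarrow> 0 \<le> x i" "(\<Sum>i\<in>V. x i * x i) = 1"
    and max: "\<And>y. \<lbrakk>\<And>i. i \<in> V \<Longrightarrow> 0 \<le> y i; (\<Sum>i\<in>V. y i * y i) = 1\<rbrakk>
      \<Longrightarrow> quad_form V A y \<le> quad_form V A x"
    by (rule rayleigh_quotient_max[of V A]) auto
  define r where "r = quad_form V A x"
  \<comment> \<open>The maximum was taken over nonnegative vectors. As \<open>A\<close> is
    nonnegative, passing to absolute values does not decrease the form, so by homogeneity the bound
    holds for all vectors and perturbations of \<open>x\<close> may have any sign.\<close>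
  have bound: "quad_form V A y \<le> r * (\<Sum>i\<in>V. y i * y i)" for y
  proof (cases "(\<Sum>i\<in>V. y i * y i) = 0")
    case True
    then have "y i = 0" if "i \<in> V" for i
      using fin that by (subst (asm) sum_nonneg_eq_0_iff) auto
    then show ?thesis
      by (simp add: quad_form_def)
  next
    case False
    define N where "N = sqrt (\<Sum>i\<in>V. y i * y i)"
    have N2: "N\<^sup>2 = (\<Sum>i\<in>V. y i * y i)"
      by (simp add: N_def sum_nonneg)
    with False have "N \<noteq> 0"
      by auto
    have "(\<Sum>i\<in>V. (1 / N * \<bar>y i\<bar>) * (1 / N * \<bar>y i\<bar>)) = (1 / N\<^sup>2) * (\<Sum>i\<in>V. y i * y i)"
      unfolding sum_distrib_left by (intro sum.cong refl) (simp add: power2_eq_square)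
    also have "\<dots> = 1"
      using N2 False by simp
    finally have "quad_form V A (\<lambda>i. 1 / N * \<bar>y i\<bar>) \<le> r"
      unfolding r_def by (intro max) (simp_all add: N_def sum_nonneg)
    then have "quad_form V A (\<lambda>i. \<bar>y i\<bar>) \<le> r * N\<^sup>2"
      unfolding quad_form_scale using \<open>N \<noteq> 0\<close> by (simp add: power_divide field_simps)
    moreover have "quad_form V A y \<le> quad_form V A (\<lambda>i. \<bar>y i\<bar>)"
      unfolding quad_form_def sum_distrib_left
    proof (intro sum_mono)
      fix i j assume "i \<in> V" "j \<in> V"
      have "y i * (A i j * y j) \<le> \<bar>y i * (A i j * y j)\<bar>"
        by simp
      also have "\<dots> = \<bar>y i\<bar> * (A i j * \<bar>y j\<bar>)"
        using nonneg[OF \<open>i \<in> V\<close> \<open>j \<in> V\<close>] by (simp add: abs_mult)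
      finally show "y i * (A i j * y j) \<le> \<bar>y i\<bar> * (A i j * \<bar>y j\<bar>)" .
    qed
    ultimately show ?thesis
      by (simp add: N2)
  qed
  \<comment> \<open>The residual of the eigenvalue equation; its squared norm \<open>D\<close> is to
    be shown zero.\<close>
  define d where "d i = r * x i - (\<Sum>j\<in>V. A i j * x j)" for i
  define D where "D = (\<Sum>i\<in>V. d i * d i)"
  define c where "c = r * D - quad_form V A d"
  have "0 \<le> c"
    using bound[of d] by (simp add: c_def D_def)
  define P where "P = (\<Sum>i\<in>V. d i * x i)"
  define R where "R = (\<Sum>i\<in>V. d i * (\<Sum>j\<in>V. A i j * x j))"
  have D_alt: "D = r * P - R"
    unfolding D_def P_def R_def sum_distrib_left[of r] sum_subtractf[symmetric]
    by (intro sum.cong refl) (subst (2) d_def, simp add: algebra_simps)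
  \<comment> \<open>The bound is an equality at \<open>x\<close>, so along \<open>x + t d\<close>
    the constant terms cancel; by \<open>D_alt\<close> the linear coefficient is
    \<open>2 * D\<close>. A parabola that is nonnegative and vanishes at 0 has no linear
    term.\<close>
  have nonneg_quad: "0 \<le> 2 * t * D + t\<^sup>2 * c" for t
  proof -
    have "(\<Sum>i\<in>V. (x i + t * d i) * (x i + t * d i)) = (\<Sum>i\<in>V. x i * x i) + 2 * t * P + t\<^sup>2 * D"
      unfolding D_def P_def sum_distrib_left sum.distrib[symmetric]
      by (intro sum.cong refl) (simp add: algebra_simps power2_eq_square)
    then have "r + 2 * t * R + t\<^sup>2 * quad_form V A d \<le> r * (1 + 2 * t * P + t\<^sup>2 * D)"
      using bound[of "\<lambda>i. x i + t * d i"] x(2) quad_form_add[OF sym, where V = V and x = x and y = d and t = t]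
      by (simp add: r_def R_def)
    also have "\<dots> = r + 2 * t * R + t\<^sup>2 * quad_form V A d + (2 * t * D + t\<^sup>2 * c)"
      by (simp add: D_alt c_def algebra_simps)
    finally show ?thesis
      by simp
  qed
  \<comment> \<open>The vertex would be at \<open>- D / c\<close>. The denominator
    \<open>c + 1\<close> is positive even for \<open>c = 0\<close>, and after clearing it the value
    is \<open>- D\<^sup>2 * (c + 2)\<close>.\<close>
  define t where "t = - D / (c + 1)"
  have "0 \<le> (2 * t * D + t\<^sup>2 * c) * (c + 1)\<^sup>2"
    by (intro mult_nonneg_nonneg nonneg_quad) simp
  also have "\<dots> = 2 * (t * (c + 1)) * D * (c + 1) + (t * (c + 1))\<^sup>2 * c"
    by (simp add: power2_eq_square algebra_simps)
  also have "t * (c + 1) = - D"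
    using \<open>0 \<le> c\<close> by (simp add: t_def)
  finally have "D\<^sup>2 * (c + 2) \<le> 0"
    by (simp add: power2_eq_square algebra_simps)
  then have "D = 0"
    using \<open>0 \<le> c\<close> by (simp add: mult_le_0_iff)
  then have "d i = 0" if "i \<in> V" for i
    using fin that unfolding D_def by (subst (asm) sum_nonneg_eq_0_iff) auto
  then have eig: "(\<Sum>j\<in>V. A i j * x j) = r * x i" if "i \<in> V" for i
    using that by (simp add: d_def)
  show ?thesis
  proof (rule that[of x r])
    show "0 < x i" if "i \<in> V" for i
    proof (rule ccontr)
      assume "\<not> 0 < x i"
      with x(1)[OF that] have "x i = 0"
        by simp
      then have "x j = 0" if "j \<in> V" for j
        using irreducible_eigenvector_zero[OF fin irr nonneg x(1) eig \<open>i \<in> V\<close> \<open>x i = 0\<close> that] by simp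
      with x(2) show False
        by simp
    qed
  qed (use x(2) eig in auto)
qed

text \<open>Pairing \<open>x\<close> with \<open>y\<close> through the symmetric \<open>A\<close>
  forces equal eigenvalues, because the inner product of positive vectors is nonzero. Then
  subtracting the right multiple of \<open>y\<close> from \<open>x\<close> leaves a nonnegative
  eigenvector with a zero entry, which must vanish.\<close>

theorem perron_vector_unique:
  assumes fin: "finite V" and irr: "irreducible_matrix V A"
    and nonneg: "\<And>i j. i \<in> V \<Longrightarrow> j \<in> V \<Longrightarrow> 0 \<le> A i j"
    and sym: "\<And>i j. i \<in> V \<Longrightarrow> j \<in> V \<Longrightarrow> A i j = A j i"
    and x: "\<And>i. i \<in> V \<Longrightarrow> 0 < x i" "\<And>i. i \<in> V \<Longrightarrow> (\<Sum>j\<in>V. A i j * x j) = r * x i"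
    and y: "\<And>i. i \<in> V \<Longrightarrow> 0 < y i" "\<And>i. i \<in> V \<Longrightarrow> (\<Sum>j\<in>V. A i j * y j) = s * y i"
  obtains t where "0 < t" "\<And>i. i \<in> V \<Longrightarrow> x i = t * y i"
proof -
  have ne: "V \<noteq> {}"
    using irr by (simp add: irreducible_matrix_def)
  have "s * (\<Sum>i\<in>V. x i * y i) = (\<Sum>i\<in>V. x i * (\<Sum>j\<in>V. A i j * y j))"
    unfolding sum_distrib_left[of s] by (intro sum.cong refl) (simp add: y(2))
  also have "\<dots> = (\<Sum>j\<in>V. \<Sum>i\<in>V. x i * (A i j * y j))"
    unfolding sum_distrib_left by (rule sum.swap)
  also have "\<dots> = (\<Sum>j\<in>V. y j * (\<Sum>i\<in>V. A j i * x i))"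
    unfolding sum_distrib_left by (intro sum.cong refl) (simp add: sym)
  also have "\<dots> = r * (\<Sum>i\<in>V. x i * y i)"
    unfolding sum_distrib_left[of r] by (intro sum.cong refl) (simp add: x(2))
  finally have "s * (\<Sum>i\<in>V. x i * y i) = r * (\<Sum>i\<in>V. x i * y i)" .
  moreover have "(\<Sum>i\<in>V. x i * y i) > 0"
    using x(1) y(1) fin ne by (intro sum_pos) auto
  ultimately have "s = r"
    by simp
  \<comment> \<open>The largest factor with \<open>t * y\<close> below \<open>x\<close> on
    \<open>V\<close>; where the minimum is attained, the difference is zero.\<close>
  define t where "t = Min ((\<lambda>i. x i / y i) ` V)"
  have "t \<in> (\<lambda>i. x i / y i) ` V"
    unfolding t_def using fin ne by (intro Min_in) auto
  then obtain k where k: "k \<in> V" "t = x k / y k"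
    by blast
  have le: "t \<le> x i / y i" if "i \<in> V" for i
    unfolding t_def using fin that by (intro Min_le) auto
  have "x i - t * y i = 0" if "i \<in> V" for i
  proof (rule irreducible_eigenvector_zero[OF fin irr nonneg _ _ k(1) _ that])
    show "0 \<le> x j - t * y j" if "j \<in> V" for j
      using le[OF that] y(1)[OF that] by (simp add: field_simps)
    show "(\<Sum>j\<in>V. A j' j * (x j - t * y j)) = r * (x j' - t * y j')" if "j' \<in> V" for j'
    proof -
      have "(\<Sum>j\<in>V. A j' j * (x j - t * y j)) = (\<Sum>j\<in>V. A j' j * x j) - t * (\<Sum>j\<in>V. A j' j * y j)"
        by (simp add: sum_distrib_left sum_subtractf right_diff_distrib mult.left_commute)
      then show ?thesis
        using that by (simp add: x(2) y(2) \<open>s = r\<close> right_diff_distrib)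
    qed
    show "x k - t * y k = 0"
      using k y(1)[OF k(1)] by simp
  qed auto
  moreover have "0 < t"
    using k x(1) y(1) by simp
  ultimately show ?thesis
    using that[of t] by simp
qed

section \<open>Adjacency tensors and monomials of hyperedges\<close>

text \<open>The number of permutations times the product \<open>F\<close> of the factorials of the
  multiplicities is the factorial of the size, and \<open>F\<close> is multiplicative on disjoint
  supports. Cancelling \<open>F A * F B\<close> leaves the binomial coefficient, which chooses the
  positions taken by \<open>A\<close>.\<close>

lemma card_permutations_of_multiset_disjoint_add:
  assumes "set_mset A \<inter> set_mset B = {}"
  shows "card (permutations_of_multiset (A + B)) =
    (size A + size B choose size A) * card (permutations_of_multiset A) * card (permutations_of_multiset B)"
proof -
  have AB: "count B x = 0" if "x \<in># A" for x
    using assms that by (simp add: disjoint_iff not_in_iff)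
  have BA: "count A x = 0" if "x \<in># B" for x
    using assms that by (metis disjoint_iff not_in_iff)
  define F :: "'a multiset \<Rightarrow> nat" where "F M = (\<Prod>x\<in>set_mset M. fact (count M x))" for M
  have F: "card (permutations_of_multiset M) * F M = fact (size M)" for M
    by (simp add: F_def card_permutations_of_multiset_aux)
  have "F (A + B) = (\<Prod>x\<in>set_mset A. fact (count (A + B) x)) * (\<Prod>x\<in>set_mset B. fact (count (A + B) x))"
    unfolding F_def set_mset_union using assms by (intro prod.union_disjoint) auto
  also have "(\<Prod>x\<in>set_mset A. fact (count (A + B) x)) = F A"
    unfolding F_def by (intro prod.cong refl) (simp add: AB)
  also have "(\<Prod>x\<in>set_mset B. fact (count (A + B) x)) = F B"
    unfolding F_def by (intro prod.cong refl) (simp add: BA)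
  finally have "card (permutations_of_multiset (A + B)) * (F A * F B) = fact (size A + size B)"
    using F[of "A + B"] by simp
  also have "\<dots> = fact (size A) * fact (size B) * (size A + size B choose size A)"
    using binomial_fact_lemma[of "size A" "size A + size B"] by simp
  also have "\<dots> = (size A + size B choose size A) * card (permutations_of_multiset A)
      * card (permutations_of_multiset B) * (F A * F B)"
    by (simp flip: F)
  finally show ?thesis
    by (simp add: F_def)
qed

text \<open>For a hyperedge \<open>e\<close>, the permutations are the index tuples that list
  \<open>e\<close>, so this is the whole contribution of \<open>e\<close> to the homogeneous form of
  the adjacency tensor at \<open>c\<close>.\<close>

definition monomial :: "'a hypergraph \<Rightarrow> ('a \<Rightarrow> real) \<Rightarrow> 'a multiset \<Rightarrow> real" where
  "monomial H c e = weight H e * card (permutations_of_multiset e) * (\<Prod>x\<in>#e. c x)"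

lemma finite_index_tuples: "finite V \<Longrightarrow> finite (index_tuples V k)"
  using finite_lists_length_eq[of V k] by (simp add: index_tuples_def conj_commute)

text \<open>The tuples with a nonzero entry are grouped by the hyperedge that they complete together
  with \<open>i\<close>: those belonging to \<open>e\<close> are the permutations of
  \<open>e - {#i#}\<close>, and \<open>e\<close> is recovered from them by adding
  \<open>i\<close>.\<close>

lemma tensor_apply_adjacency:
  assumes "hypergraph H" and "uniform m H"
  shows "tensor_apply (nodes H) m (adjacency_tensor H) c i =
    (\<Sum>e\<in>{e \<in> hyperedges H. i \<in># e}.
       weight H e * card (permutations_of_multiset (e - {#i#})) * (\<Prod>x\<in>#e - {#i#}. c x))"
proof -
  let ?V = "nodes H" and ?E = "{e \<in> hyperedges H. i \<in># e}"
  have fin: "finite ?V" "finite (hyperedges H)"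
    using assms(1) by (auto simp: hypergraph_def)
  have tuples: "{js \<in> index_tuples ?V (m - 1). add_mset i (mset js) \<in> hyperedges H} =
      (\<Union>e\<in>?E. permutations_of_multiset (e - {#i#}))"
  proof (intro equalityI subsetI)
    fix js assume "js \<in> {js \<in> index_tuples ?V (m - 1). add_mset i (mset js) \<in> hyperedges H}"
    then show "js \<in> (\<Union>e\<in>?E. permutations_of_multiset (e - {#i#}))"
      by (auto intro!: bexI[of _ "add_mset i (mset js)"] simp: permutations_of_multiset_def)
  next
    fix js assume "js \<in> (\<Union>e\<in>?E. permutations_of_multiset (e - {#i#}))"
    then obtain e where e: "e \<in> hyperedges H" "i \<in># e" "mset js = e - {#i#}"
      by (auto simp: permutations_of_multiset_def)
    then have e_eq: "e = add_mset i (mset js)"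
      by simp
    have "size e = m" "set_mset e \<subseteq> ?V"
      using assms e(1) by (auto simp: uniform_def hypergraph_def)
    then show "js \<in> {js \<in> index_tuples ?V (m - 1). add_mset i (mset js) \<in> hyperedges H}"
      using e(1) by (auto simp: e_eq index_tuples_def)
  qed
  have "tensor_apply ?V m (adjacency_tensor H) c i =
      (\<Sum>js\<in>{js \<in> index_tuples ?V (m - 1). add_mset i (mset js) \<in> hyperedges H}.
         weight H (add_mset i (mset js)) * prod_list (map c js))"
    unfolding tensor_apply_def adjacency_tensor_def
    by (subst sum.inter_filter) (auto intro!: sum.cong simp: finite_index_tuples fin)
  also have "\<dots> = (\<Sum>e\<in>?E. \<Sum>js\<in>permutations_of_multiset (e - {#i#}).
         weight H (add_mset i (mset js)) * prod_list (map c js))"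
    unfolding tuples
  proof (rule sum.UNION_disjoint)
    show "\<forall>e\<in>?E. \<forall>f\<in>?E. e \<noteq> f \<longrightarrow>
        permutations_of_multiset (e - {#i#}) \<inter> permutations_of_multiset (f - {#i#}) = {}"
      by (auto simp: permutations_of_multiset_def) (metis insert_DiffM)
  qed (use fin in auto)
  also have "\<dots> = (\<Sum>e\<in>?E. \<Sum>js\<in>permutations_of_multiset (e - {#i#}).
         weight H e * (\<Prod>x\<in>#e - {#i#}. c x))"
  proof (intro sum.cong refl)
    fix e js assume "e \<in> ?E" "js \<in> permutations_of_multiset (e - {#i#})"
    then have e: "i \<in># e" and js: "mset js = e - {#i#}"
      by (auto simp: permutations_of_multiset_def)
    have "prod_list (map c js) = (\<Prod>x\<in>#mset js. c x)"
      by (metis mset_map prod_mset_prod_list)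
    with e show "weight H (add_mset i (mset js)) * prod_list (map c js) = weight H e * (\<Prod>x\<in>#e - {#i#}. c x)"
      by (simp add: js)
  qed
  finally show ?thesis
    by (simp add: mult_ac)
qed

text \<open>Among the permutations of a hyperedge of size \<open>m\<close>, those that start with
  \<open>i\<close> form the fraction \<open>count e i / m\<close>. The factor \<open>m * c i\<close>
  therefore completes each reduced monomial to the full one, weighted by the multiplicity of
  \<open>i\<close>.\<close>

lemma tensor_apply_count:
  assumes "hypergraph H" and "uniform m H"
  shows "m * (c i * tensor_apply (nodes H) m (adjacency_tensor H) c i) =
    (\<Sum>e\<in>hyperedges H. count e i * monomial H c e)"
proof -
  let ?E = "{e \<in> hyperedges H. i \<in># e}"
  have fin: "finite (hyperedges H)"
    using assms(1) by (simp add: hypergraph_def)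
  have "m * (c i * tensor_apply (nodes H) m (adjacency_tensor H) c i) =
      (\<Sum>e\<in>?E. count e i * monomial H c e)"
    unfolding tensor_apply_adjacency[OF assms] sum_distrib_left
  proof (intro sum.cong refl)
    fix e assume e: "e \<in> ?E"
    have "size e = m"
      using assms(2) e by (auto simp: uniform_def)
    then have "card (permutations_of_multiset e) * count e i = m * card (permutations_of_multiset (e - {#i#}))"
      using card_permutations_of_multiset_remove_aux[of i e] e by simp
    then have 1: "real (card (permutations_of_multiset e)) * count e i =
        m * card (permutations_of_multiset (e - {#i#}))"
      by (metis of_nat_mult)
    have "e = add_mset i (e - {#i#})"
      using e by simp
    then have 2: "(\<Prod>x\<in>#e. c x) = c i * (\<Prod>x\<in>#e - {#i#}. c x)"
      by (metis image_mset_add_mset prod_mset.add_mset)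
    have "m * (c i * (weight H e * card (permutations_of_multiset (e - {#i#})) * (\<Prod>x\<in>#e - {#i#}. c x))) =
        (m * card (permutations_of_multiset (e - {#i#}))) * (weight H e * (c i * (\<Prod>x\<in>#e - {#i#}. c x)))"
      by (simp add: mult_ac)
    also have "\<dots> = count e i * monomial H c e"
      unfolding 1[symmetric] 2[symmetric] monomial_def by (simp add: mult_ac)
    finally show "m * (c i * (weight H e * card (permutations_of_multiset (e - {#i#})) * (\<Prod>x\<in>#e - {#i#}. c x))) =
        count e i * monomial H c e" .
  qed
  also have "\<dots> = (\<Sum>e\<in>hyperedges H. count e i * monomial H c e)"
    using fin by (intro sum.mono_neutral_left) (auto simp: not_in_iff)
  finally show ?thesis .
qed

lemma monomial_pos:
  assumes "hypergraph H" and "e \<in> hyperedges H" and "\<And>i. i \<in> nodes H \<Longrightarrow> 0 < c i"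
  shows "0 < monomial H c e"
proof -
  have "\<forall>i\<in>#e. 0 < c i"
    using assms by (auto simp: hypergraph_def)
  then have "0 < (\<Prod>x\<in>#e. c x)"
    by (induction e) auto
  moreover have "0 < weight H e"
    using assms by (simp add: hypergraph_def)
  moreover have "0 < card (permutations_of_multiset e)"
    by (simp add: card_gt_0_iff)
  ultimately show ?thesis
    by (simp add: monomial_def)
qed

section \<open>Adjacency matrices of pairwise graphs and irreducibility\<close>

definition adjacency_matrix :: "'a hypergraph \<Rightarrow> 'a \<Rightarrow> 'a \<Rightarrow> real" where
  "adjacency_matrix G i j = adjacency_tensor G [i, j]"

lemma adjacency_matrix_sym: "adjacency_matrix G i j = adjacency_matrix G j i"
  by (simp add: adjacency_matrix_def adjacency_tensor_def add_mset_commute)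

lemma adjacency_matrix_nonneg: "hypergraph G \<Longrightarrow> 0 \<le> adjacency_matrix G i j"
  by (auto simp: adjacency_matrix_def adjacency_tensor_def hypergraph_def less_imp_le)

lemma adjacency_matrix_eq_0_iff:
  "hypergraph G \<Longrightarrow> adjacency_matrix G i j = 0 \<longleftrightarrow> {#i, j#} \<notin> hyperedges G"
  by (force simp: adjacency_matrix_def adjacency_tensor_def hypergraph_def)

lemma tensor_apply_2: "tensor_apply V 2 T c i = (\<Sum>j\<in>V. T [i, j] * c j)"
proof -
  have "index_tuples V 1 = (\<lambda>j. [j]) ` V"
    by (auto simp: index_tuples_def length_Suc_conv)
  then show ?thesis
    by (simp add: tensor_apply_def sum.reindex inj_on_def)
qed

lemma adjacency_matrix_count:
  assumes "pairwise_graph G"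
  shows "2 * (c i * (\<Sum>j\<in>nodes G. adjacency_matrix G i j * c j)) =
    (\<Sum>e\<in>hyperedges G. count e i * monomial G c e)"
  using tensor_apply_count[of G 2 c i] assms
  by (simp add: pairwise_graph_def tensor_apply_2 adjacency_matrix_def)

text \<open>A handshake argument: summed over all nodes, the multiplicities in an edge give 2, loops
  included, which cancels the factor 2 of \<open>adjacency_matrix_count\<close>.\<close>

lemma quad_form_adjacency_matrix:
  assumes "pairwise_graph G"
  shows "quad_form (nodes G) (adjacency_matrix G) c = (\<Sum>e\<in>hyperedges G. monomial G c e)"
proof -
  have count2: "(\<Sum>i\<in>nodes G. count e i) = 2" if "e \<in> hyperedges G" for e
  proof -
    have e: "set_mset e \<subseteq> nodes G" "finite (nodes G)" "size e = 2"
      using assms that by (auto simp: pairwise_graph_def hypergraph_def uniform_def)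
    then have "(\<Sum>i\<in>nodes G. count e i) = (\<Sum>i\<in>set_mset e. count e i)"
      by (intro sum.mono_neutral_right) (auto simp: not_in_iff)
    then show ?thesis
      using e by (simp add: size_multiset_overloaded_eq)
  qed
  have "2 * quad_form (nodes G) (adjacency_matrix G) c =
      (\<Sum>i\<in>nodes G. \<Sum>e\<in>hyperedges G. count e i * monomial G c e)"
    unfolding quad_form_def by (simp add: sum_distrib_left[of 2] adjacency_matrix_count[OF assms])
  also have "\<dots> = (\<Sum>e\<in>hyperedges G. (\<Sum>i\<in>nodes G. count e i) * monomial G c e)"
    by (subst sum.swap) (simp add: sum_distrib_right)
  also have "\<dots> = 2 * (\<Sum>e\<in>hyperedges G. monomial G c e)"
    unfolding sum_distrib_left by (intro sum.cong refl) (simp add: count2)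
  finally show ?thesis
    by simp
qed

lemma irreducible_adjacency_matrix:
  assumes "strongly_connected 2 G"
  shows "irreducible_matrix (nodes G) (adjacency_matrix G)"
proof -
  \<comment> \<open>At order 2 the sum defining weak irreducibility has the empty tuple as its only
    index, and absolute values do not change which entries vanish.\<close>
  have "index_tuples (nodes G) 0 = {[]}"
    by (auto simp: index_tuples_def)
  then show ?thesis
    using assms by (simp add: strongly_connected_def weakly_irreducible_def irreducible_matrix_def adjacency_matrix_def)
qed

text \<open>Only the zero pattern matters. This carries irreducibility from the weights of
  \<open>G\<close> over to those pulled back from \<open>H\<close>.\<close>

lemma irreducible_matrix_cong:
  assumes "\<And>i j. i \<in> V \<Longrightarrow> j \<in> V \<Longrightarrow> A i j = 0 \<longleftrightarrow> B i j = 0"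
  shows "irreducible_matrix V A \<longleftrightarrow> irreducible_matrix V B"
proof -
  have "(\<forall>i\<in>S. \<forall>j\<in>V - S. A i j = 0) \<longleftrightarrow> (\<forall>i\<in>S. \<forall>j\<in>V - S. B i j = 0)" if "S \<subset> V" for S
    using assms that by blast
  then show ?thesis
    unfolding irreducible_matrix_def by (simp cong: conj_cong)
qed

text \<open>Without hyperedges the matrix is zero, and a single node splits off as a block. Two
  distinct nodes make that block proper, as the zero matrix on one node is irreducible.\<close>

lemma strongly_connected_hyperedges:
  assumes "strongly_connected m H" and "i \<in> nodes H" "j \<in> nodes H" "i \<noteq> j"
  shows "hyperedges H \<noteq> {}"
proof
  assume "hyperedges H = {}"
  then have "irreducible_matrix (nodes H) (\<lambda>i j. 0)"
    using assms(1) by (simp add: strongly_connected_def weakly_irreducible_def adjacency_tensor_def)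
  moreover have "{i} \<noteq> {}" "{i} \<subset> nodes H"
    using assms by auto
  ultimately show False
    unfolding irreducible_matrix_def by blast
qed

section \<open>Uplifted graphs\<close>

definition auxiliary_part :: "'a set \<Rightarrow> ('a \<Rightarrow> nat) \<Rightarrow> 'a multiset" where
  "auxiliary_part S p = (\<Sum>k\<in>S. replicate_mset (p k) k)"

lemma count_auxiliary_part:
  "finite S \<Longrightarrow> count (auxiliary_part S p) i = (if i \<in> S then p i else 0)"
  by (simp add: auxiliary_part_def count_sum)

lemma size_auxiliary_part: "size (auxiliary_part S p) = (\<Sum>k\<in>S. p k)"
  by (simp add: auxiliary_part_def size_multiset_sum)

lemma prod_auxiliary_part:
  "(\<Prod>x\<in>#auxiliary_part S p. c x) = (\<Prod>k\<in>S. c k ^ p k)" for c :: "'a \<Rightarrow> real"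
  by (induction S rule: infinite_finite_induct) (auto simp: auxiliary_part_def)

text \<open>The weights that matter on \<open>G\<close> are those of \<open>H\<close>, to which its own weights are unrelated.\<close>

definition pullback_weight :: "'a hypergraph \<Rightarrow> 'a multiset \<Rightarrow> 'a hypergraph \<Rightarrow> 'a hypergraph" where
  "pullback_weight H P G = G\<lparr>weight := \<lambda>e. weight H (e + P)\<rparr>"

lemma pullback_weight_simps [simp]:
  "nodes (pullback_weight H P G) = nodes G"
  "hyperedges (pullback_weight H P G) = hyperedges G"
  "weight (pullback_weight H P G) e = weight H (e + P)"
  by (simp_all add: pullback_weight_def)

locale uplifted_graph =
  fixes m :: nat and G H :: "'a hypergraph" and S :: "'a set" and p :: "'a \<Rightarrow> nat"
  assumes H: "hypergraph H" and G: "pairwise_graph G"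
    and S: "finite S" "S \<inter> nodes G = {}" and p_sum: "(\<Sum>k\<in>S. p k) + 2 = m"
    and nodes_H: "nodes H = nodes G \<union> S"
    and hyperedges_H: "hyperedges H = (\<lambda>e. e + auxiliary_part S p) ` hyperedges G"
begin

abbreviation P :: "'a multiset" where "P \<equiv> auxiliary_part S p"

abbreviation G' :: "'a hypergraph" where "G' \<equiv> pullback_weight H P G"

abbreviation A :: "'a \<Rightarrow> 'a \<Rightarrow> real" where "A \<equiv> adjacency_matrix G'"

lemma G': "pairwise_graph G'"
  using G H by (auto simp: pairwise_graph_def hypergraph_def uniform_def hyperedges_H)

lemma finite_nodes_G: "finite (nodes G)"
  using G by (simp add: pairwise_graph_def hypergraph_def)

lemma m_pos: "0 < m"
  using p_sum by simp

lemma uniform_H: "uniform m H"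
  using G p_sum by (auto simp: pairwise_graph_def uniform_def hyperedges_H size_auxiliary_part)

text \<open>The factor common to all hyperedges: the choice of the two positions held by graph
  nodes, the arrangements of the auxiliary nodes, and the product of their entries.\<close>

definition K :: "('a \<Rightarrow> real) \<Rightarrow> real" where
  "K c = real ((m choose 2) * card (permutations_of_multiset P)) * (\<Prod>k\<in>S. c k ^ p k)"

lemma K_pos: "0 < K c" if "\<And>i. i \<in> nodes H \<Longrightarrow> 0 < c i"
proof -
  have "0 < (\<Prod>k\<in>S. c k ^ p k)"
    using that by (intro prod_pos) (auto simp: nodes_H)
  moreover have "0 < m choose 2"
    using p_sum by (simp add: zero_less_binomial_iff)
  moreover have "0 < card (permutations_of_multiset P)"
    by (simp add: card_gt_0_iff)
  ultimately show ?thesis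
    by (simp add: K_def)
qed

text \<open>Graph nodes and auxiliary nodes are disjoint, so both the permutation count and the
  product of entries factor. No weight is left over, since \<open>G'\<close> carries the weights of
  \<open>H\<close>.\<close>

lemma monomial_uplift:
  assumes "e \<in> hyperedges G"
  shows "monomial H c (e + P) = K c * monomial G' c e"
proof -
  have e: "set_mset e \<subseteq> nodes G" "size e = 2"
    using G assms by (auto simp: pairwise_graph_def hypergraph_def uniform_def)
  have "set_mset P \<subseteq> S"
    using S(1) by (auto simp flip: count_greater_zero_iff simp: count_auxiliary_part split: if_splits)
  then have "set_mset e \<inter> set_mset P = {}"
    using e S(2) by blast
  then have "card (permutations_of_multiset (e + P)) =
      (m choose 2) * card (permutations_of_multiset e) * card (permutations_of_multiset P)"
    using e p_sum by (simp add: card_permutations_of_multiset_disjoint_add size_auxiliary_part add.commute)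
  then show ?thesis
    by (simp add: monomial_def K_def prod_auxiliary_part)
qed

lemma tensor_apply_uplift:
  "m * (c i * tensor_apply (nodes H) m (adjacency_tensor H) c i) =
    K c * (\<Sum>e\<in>hyperedges G. (count e i + count P i) * monomial G' c e)"
proof -
  have "inj_on (\<lambda>e. e + P) (hyperedges G)"
    by (simp add: inj_on_def)
  then show ?thesis
    unfolding tensor_apply_count[OF H uniform_H] hyperedges_H
    by (simp add: sum.reindex monomial_uplift sum_distrib_left mult_ac)
qed

lemma tensor_apply_graph_node:
  assumes "i \<in> nodes G"
  shows "m * (c i * tensor_apply (nodes H) m (adjacency_tensor H) c i) =
    2 * K c * (c i * (\<Sum>j\<in>nodes G. A i j * c j))"
proof -
  have "count P i = 0"
    using S assms by (auto simp: count_auxiliary_part)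
  then show ?thesis
    using adjacency_matrix_count[OF G', of c i] by (simp add: tensor_apply_uplift)
qed

text \<open>The node \<open>k\<close> lies in every hyperedge with the same multiplicity
  \<open>p k\<close>, so its equation sees only the sum of all monomials, which is the quadratic
  form.\<close>

lemma tensor_apply_auxiliary_node:
  assumes "k \<in> S"
  shows "m * (c k * tensor_apply (nodes H) m (adjacency_tensor H) c k) =
    K c * p k * quad_form (nodes G) A c"
proof -
  have "count e k = 0" if "e \<in> hyperedges G" for e
    using G S assms that by (force simp: pairwise_graph_def hypergraph_def simp flip: not_in_iff)
  then show ?thesis
    using quad_form_adjacency_matrix[OF G', of c] S(1) assms
    by (simp add: tensor_apply_uplift count_auxiliary_part sum_distrib_left mult_ac)
qed

text \<open>At graph nodes the positive entry \<open>c i\<close> cancels and an eigenvalue equation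
  for \<open>A\<close> remains. At an auxiliary node the equation reads
  \<open>m * l * (c k * c k) = K c * p k * Q\<close> with \<open>Q = r * N\<close>, and cancelling
  \<open>K c * r\<close> fixes \<open>c k * c k\<close>. Without edges this would fail: the tensor
  is then zero and leaves the auxiliary entries free.\<close>

lemma eigenvector_iff:
  assumes pos: "\<And>i. i \<in> nodes H \<Longrightarrow> 0 < c i"
    and edges: "S \<noteq> {} \<Longrightarrow> hyperedges G \<noteq> {}"
  shows "(\<exists>l. \<forall>i\<in>nodes H. tensor_apply (nodes H) m (adjacency_tensor H) c i = l * c i) \<longleftrightarrow>
    (\<exists>r. \<forall>i\<in>nodes G. (\<Sum>j\<in>nodes G. A i j * c j) = r * c i) \<and>
    (\<forall>k\<in>S. c k * c k = p k / 2 * (\<Sum>i\<in>nodes G. c i * c i))" (is "?lhs \<longleftrightarrow> ?rhs")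
proof -
  let ?T = "tensor_apply (nodes H) m (adjacency_tensor H) c"
  define Q where "Q = quad_form (nodes G) A c"
  define N where "N = (\<Sum>i\<in>nodes G. c i * c i)"
  have K: "0 < K c"
    using pos by (rule K_pos)
  have m: "0 < real m"
    using m_pos by simp
  have T_graph: "m * ?T i = 2 * K c * (\<Sum>j\<in>nodes G. A i j * c j)" if "i \<in> nodes G" for i
    using tensor_apply_graph_node[OF that, of c] pos[of i] that
    by (simp add: nodes_H mult.left_commute[of _ "c i"])
  have T_aux: "m * (c k * ?T k) = K c * p k * Q" if "k \<in> S" for k
    using tensor_apply_auxiliary_node[OF that] by (simp add: Q_def)
  have Q_eq: "Q = r * N" if "\<forall>i\<in>nodes G. (\<Sum>j\<in>nodes G. A i j * c j) = r * c i" for r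
    unfolding Q_def N_def quad_form_def sum_distrib_left[of r] using that by (intro sum.cong) simp_all
  have Q_pos: "0 < Q" if "S \<noteq> {}"
  proof -
    have "Q = (\<Sum>e\<in>hyperedges G. monomial G' c e)"
      using quad_form_adjacency_matrix[OF G', of c] by (simp add: Q_def)
    also have "\<dots> > 0"
    proof (rule sum_pos)
      show "finite (hyperedges G)"
        using G by (simp add: pairwise_graph_def hypergraph_def)
      show "0 < monomial G' c e" if "e \<in> hyperedges G" for e
        using G' pos that by (intro monomial_pos) (auto simp: pairwise_graph_def nodes_H)
    qed (rule edges[OF that])
    finally show ?thesis .
  qed
  show ?thesis
  proof
    assume ?lhs
    then obtain l where l: "\<And>i. i \<in> nodes H \<Longrightarrow> ?T i = l * c i"
      by blast
    \<comment> \<open>The equations at graph nodes dictate \<open>m * l = 2 * K c * r\<close>; the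
      converse direction solves the same relation for \<open>l\<close>.\<close>
    define r where "r = m * l / (2 * K c)"
    have ml: "m * l = 2 * K c * r"
      using K by (simp add: r_def)
    have r: "\<forall>i\<in>nodes G. (\<Sum>j\<in>nodes G. A i j * c j) = r * c i"
    proof
      fix i assume i: "i \<in> nodes G"
      have "2 * K c * (\<Sum>j\<in>nodes G. A i j * c j) = m * l * c i"
        using T_graph[OF i] l[of i] i by (simp add: nodes_H)
      also have "\<dots> = 2 * K c * (r * c i)"
        unfolding ml by simp
      finally show "(\<Sum>j\<in>nodes G. A i j * c j) = r * c i"
        using K by simp
    qed
    moreover have "c k * c k = p k / 2 * N" if k: "k \<in> S" for k
    proof -
      \<comment> \<open>An auxiliary node exists, so there are edges and \<open>Q = r * N\<close> is
        positive.\<close>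
      have "r \<noteq> 0"
        using Q_eq[OF r] Q_pos k by force
      have "(2 * K c * r) * (c k * c k) = m * (c k * (l * c k))"
        unfolding ml[symmetric] by simp
      also have "\<dots> = K c * p k * (r * N)"
        using T_aux[OF k] l[of k] k Q_eq[OF r] by (simp add: nodes_H)
      also have "\<dots> = (2 * K c * r) * (p k / 2 * N)"
        by simp
      finally show ?thesis
        using K \<open>r \<noteq> 0\<close> by (metis mult_left_cancel mult_eq_0_iff less_irrefl zero_neq_numeral)
    qed
    ultimately show ?rhs
      unfolding N_def by blast
  next
    assume ?rhs
    then obtain r where r: "\<forall>i\<in>nodes G. (\<Sum>j\<in>nodes G. A i j * c j) = r * c i"
      and aux: "\<And>k. k \<in> S \<Longrightarrow> c k * c k = p k / 2 * N"
      unfolding N_def by blast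
    define l where "l = 2 * K c * r / m"
    have ml: "m * l = 2 * K c * r"
      using m by (simp add: l_def)
    have "?T i = l * c i" if i: "i \<in> nodes H" for i
    proof (cases "i \<in> nodes G")
      case True
      have "m * ?T i = m * (l * c i)"
        using T_graph[OF True] r True ml by (simp flip: mult.assoc)
      then show ?thesis
        using m by simp
    next
      case False
      with i have k: "i \<in> S"
        by (simp add: nodes_H)
      have "m * (c i * ?T i) = (2 * K c * r) * (p i / 2 * N)"
        using T_aux[OF k] Q_eq[OF r] by simp
      also have "\<dots> = m * (c i * (l * c i))"
        unfolding ml[symmetric] aux[OF k, symmetric] by simp
      finally show ?thesis
        using m pos[OF i] by simp
    qed
    then show ?lhs
      by blast
  qed
qed

text \<open>The multiplicities sum to \<open>m - 2\<close>, so the auxiliary entries add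
  \<open>(m - 2) / 2\<close> times the squared norm on \<open>G\<close> to that norm itself.\<close>

lemma sum_squares_nodes:
  assumes "\<forall>k\<in>S. c k * c k = p k / 2 * (\<Sum>i\<in>nodes G. c i * c i)"
  shows "(\<Sum>i\<in>nodes H. c i * c i) = m / 2 * (\<Sum>i\<in>nodes G. c i * c i)"
proof -
  define N where "N = (\<Sum>i\<in>nodes G. c i * c i)"
  have "(\<Sum>i\<in>nodes H. c i * c i) = N + (\<Sum>k\<in>S. c k * c k)"
    unfolding nodes_H N_def using S finite_nodes_G by (intro sum.union_disjoint) auto
  also have "(\<Sum>k\<in>S. c k * c k) = (\<Sum>k\<in>S. p k / 2 * N)"
    using assms by (intro sum.cong refl) (simp add: N_def)
  also have "\<dots> = real (\<Sum>k\<in>S. p k) / 2 * N"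
    by (simp add: sum_distrib_right sum_divide_distrib)
  also have "N + \<dots> = m / 2 * N"
    by (simp add: field_simps flip: p_sum)
  finally show ?thesis
    by (simp add: N_def)
qed

end

section \<open>Existence and uniqueness of the positive eigenvector\<close>

theorem corollary5p6:
  fixes G H :: "'a hypergraph" and m :: nat
  assumes "hypergraph H"
    and "pairwise_graph G"
    and "uplift m G H"
    and "strongly_connected m H"
    and "strongly_connected 2 G"
  shows "\<exists>!c. Z_eigenvector (nodes H) m (adjacency_tensor H) c \<and> (\<forall>i \<in> nodes H. 0 < c i)"
proof -
  obtain S p where S: "finite S" "S \<inter> nodes G = {}" and p: "\<forall>k\<in>S. 1 \<le> p k"
    and uplift: "(\<Sum>k\<in>S. p k) + 2 = m" "nodes H = nodes G \<union> S"
      "hyperedges H = (\<lambda>e. e + auxiliary_part S p) ` hyperedges G"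
    using assms(3) unfolding uplift_def auxiliary_part_def by blast
  interpret uplifted_graph m G H S p
    using assms S uplift by unfold_locales
  have hyper: "hypergraph G" "hypergraph G'"
    using assms(2) G' by (simp_all add: pairwise_graph_def)
  \<comment> \<open>\<open>G\<close> and \<open>G'\<close> have the same hyperedges, all of positive
    weight, hence adjacency matrices with the same zero pattern.\<close>
  have irr: "irreducible_matrix (nodes G) A"
    using irreducible_adjacency_matrix[OF assms(5)] hyper
    by (subst irreducible_matrix_cong[where B = "adjacency_matrix G"])
      (simp_all add: adjacency_matrix_eq_0_iff)
  note perron = finite_nodes_G irr adjacency_matrix_nonneg[OF hyper(2)] adjacency_matrix_sym
  \<comment> \<open>A graph node and an auxiliary node are two distinct nodes of \<open>H\<close>,
    so its strong connectedness provides a hyperedge.\<close>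
  have edges: "hyperedges G \<noteq> {}" if "S \<noteq> {}"
  proof -
    have "nodes G \<noteq> {}"
      using irr by (simp add: irreducible_matrix_def)
    with that obtain i k where "i \<in> nodes G" "k \<in> S"
      by blast
    then have "hyperedges H \<noteq> {}"
      using S(2) by (intro strongly_connected_hyperedges[OF assms(4), of i k]) (auto simp: nodes_H)
    then show ?thesis
      by (simp add: hyperedges_H)
  qed
  have iff: "Z_eigenvector (nodes H) m (adjacency_tensor H) c \<longleftrightarrow>
      c \<in> extensional (nodes H) \<and> (\<Sum>i\<in>nodes G. c i * c i) = 2 / m \<and>
      (\<exists>r. \<forall>i\<in>nodes G. (\<Sum>j\<in>nodes G. A i j * c j) = r * c i) \<and>
      (\<forall>k\<in>S. c k * c k = p k / 2 * (\<Sum>i\<in>nodes G. c i * c i))"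
    if pos: "\<And>i. i \<in> nodes H \<Longrightarrow> 0 < c i" for c
  proof -
    have norm: "(\<Sum>i\<in>nodes H. c i * c i) = 1 \<longleftrightarrow> (\<Sum>i\<in>nodes G. c i * c i) = 2 / m"
      if "\<forall>k\<in>S. c k * c k = p k / 2 * (\<Sum>i\<in>nodes G. c i * c i)"
      unfolding sum_squares_nodes[OF that] using m_pos by (auto simp: field_simps)
    \<comment> \<open>The two normalisations are equivalent only once the auxiliary entries satisfy
      their equation, so \<open>norm\<close> can be used only under the conjunct
      \<open>Q\<close>.\<close>
    have "X \<and> M \<and> E \<longleftrightarrow> X \<and> N \<and> R \<and> Q"
      if "E \<longleftrightarrow> R \<and> Q" "Q \<Longrightarrow> M \<longleftrightarrow> N" for X M N E R Q
      using that by blast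
    from this[OF eigenvector_iff[OF pos edges] norm] show ?thesis
      unfolding Z_eigenvector_def .
  qed
  show ?thesis
  proof (rule ex_ex1I)
    obtain u r where u: "\<And>i. i \<in> nodes G \<Longrightarrow> 0 < u i" "(\<Sum>i\<in>nodes G. u i * u i) = 1"
        "\<And>i. i \<in> nodes G \<Longrightarrow> (\<Sum>j\<in>nodes G. A i j * u j) = r * u i"
      using perron_vector_exists[OF perron] by blast
    \<comment> \<open>Scales the unit Perron vector to squared norm \<open>2 / m\<close> on
      \<open>G\<close>.\<close>
    define s where "s = sqrt (2 / m)"
    have s: "0 < s" "s * s = 2 / m"
      using m_pos by (simp_all add: s_def)
    \<comment> \<open>With squared norm \<open>2 / m\<close> on \<open>G\<close>, the required
      square at \<open>k\<close> is \<open>p k / 2 * (2 / m) = p k / m\<close>. The value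
      \<open>undefined\<close> elsewhere puts \<open>c\<close> into
      \<open>extensional (nodes H)\<close>.\<close>
    define c where "c i = (if i \<in> nodes G then s * u i else if i \<in> S then sqrt (p i / m) else undefined)" for i
    have c_graph: "c i = s * u i" if "i \<in> nodes G" for i
      using that by (simp add: c_def)
    have c_aux: "c k = sqrt (p k / m)" if "k \<in> S" for k
      using that S(2) by (auto simp: c_def)
    have "0 < c i" if "i \<in> nodes H" for i
      using that
    proof (cases "i \<in> nodes G")
      case False
      with that have "i \<in> S"
        by (simp add: nodes_H)
      then have "0 < p i"
        using p by force
      then show ?thesis
        using c_aux[OF \<open>i \<in> S\<close>] m_pos by simp
    qed (simp add: c_graph s(1) u(1))
    moreover have norm: "(\<Sum>i\<in>nodes G. c i * c i) = 2 / m"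
    proof -
      have "(\<Sum>i\<in>nodes G. c i * c i) = s * s * (\<Sum>i\<in>nodes G. u i * u i)"
        unfolding sum_distrib_left by (intro sum.cong refl) (simp add: c_graph)
      then show ?thesis
        by (simp add: s(2) u(2))
    qed
    moreover have "(\<Sum>j\<in>nodes G. A i j * c j) = r * c i" if "i \<in> nodes G" for i
    proof -
      have "(\<Sum>j\<in>nodes G. A i j * c j) = s * (\<Sum>j\<in>nodes G. A i j * u j)"
        unfolding sum_distrib_left by (intro sum.cong refl) (simp add: c_graph)
      then show ?thesis
        by (simp add: u(3) c_graph that)
    qed
    moreover have "c k * c k = p k / 2 * (\<Sum>i\<in>nodes G. c i * c i)" if "k \<in> S" for k
      unfolding norm c_aux[OF that] by simp
    moreover have "c \<in> extensional (nodes H)"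
      by (simp add: extensional_def c_def nodes_H)
    ultimately show "\<exists>c. Z_eigenvector (nodes H) m (adjacency_tensor H) c \<and> (\<forall>i\<in>nodes H. 0 < c i)"
      using iff[of c] by blast
  next
    fix c d
    assume "Z_eigenvector (nodes H) m (adjacency_tensor H) c \<and> (\<forall>i\<in>nodes H. 0 < c i)"
      and "Z_eigenvector (nodes H) m (adjacency_tensor H) d \<and> (\<forall>i\<in>nodes H. 0 < d i)"
    then have pos: "\<And>i. i \<in> nodes H \<Longrightarrow> 0 < c i" "\<And>i. i \<in> nodes H \<Longrightarrow> 0 < d i"
      and eig: "Z_eigenvector (nodes H) m (adjacency_tensor H) c"
        "Z_eigenvector (nodes H) m (adjacency_tensor H) d"
      by auto
    obtain r where c: "c \<in> extensional (nodes H)" "(\<Sum>i\<in>nodes G. c i * c i) = 2 / m"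
        "\<And>i. i \<in> nodes G \<Longrightarrow> (\<Sum>j\<in>nodes G. A i j * c j) = r * c i"
        "\<And>k. k \<in> S \<Longrightarrow> c k * c k = p k / 2 * (\<Sum>i\<in>nodes G. c i * c i)"
      using eig(1) iff[of c, OF pos(1)] by blast
    obtain r' where d: "d \<in> extensional (nodes H)" "(\<Sum>i\<in>nodes G. d i * d i) = 2 / m"
        "\<And>i. i \<in> nodes G \<Longrightarrow> (\<Sum>j\<in>nodes G. A i j * d j) = r' * d i"
        "\<And>k. k \<in> S \<Longrightarrow> d k * d k = p k / 2 * (\<Sum>i\<in>nodes G. d i * d i)"
      using eig(2) iff[of d, OF pos(2)] by blast
    have posG: "0 < c i" "0 < d i" if "i \<in> nodes G" for i
      using pos that by (simp_all add: nodes_H)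
    obtain t where t: "0 < t" "\<And>i. i \<in> nodes G \<Longrightarrow> c i = t * d i"
      using perron_vector_unique[OF perron posG(1) c(3) posG(2) d(3)] by blast
    \<comment> \<open>Both restrictions to \<open>G\<close> have squared norm \<open>2 / m\<close>,
      so the positive ratio \<open>t\<close> must be 1.\<close>
    have "t * t * (\<Sum>i\<in>nodes G. d i * d i) = (\<Sum>i\<in>nodes G. c i * c i)"
      unfolding sum_distrib_left by (intro sum.cong refl) (simp add: t(2))
    then have "t * t = 1 * 1"
      using m_pos unfolding c(2) d(2) by simp
    then have "t = 1"
      using t(1) by (simp add: square_eq_1_iff)
    show "c = d"
    proof (rule extensionalityI[OF c(1) d(1)])
      fix i assume i: "i \<in> nodes H"
      show "c i = d i"
      proof (cases "i \<in> nodes G")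
        case True
        then show ?thesis
          using t(2) \<open>t = 1\<close> by simp
      next
        case False
        \<comment> \<open>At an auxiliary node both squares equal \<open>p i / m\<close>, and
          positivity selects the root.\<close>
        with i have "c i * c i = d i * d i"
          using c(2,4) d(2,4) by (simp add: nodes_H)
        then show ?thesis
          using pos(1)[OF i] pos(2)[OF i] by (simp add: square_eq_iff)
      qed
    qed
  qed
qed

end
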